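(* Let $G$ be a (Hausdorff) topological group with identity $e$. The following assertions are equivalent: (i) for every sequence $\{\mathcal{V}_n: n\in\omega\}$ of countable families $\mathcal{V}_n=\{V^i_n: i\in\omega\}$ of open subsets of $G$ such that $\mathcal{V}_n$ weakly converges to $e$ for every $n\in\omega$, there are strictly increasing sequences $(i_k)_{k\in\omega}$ and $(n_k)_{k\in\omega}$ in $\omega$ and a sequence $\{x_k\}_{k\in\omega}$ in $G$ such that $x_k\to e$ and $x_k\in V^{i_k}_{n_k}$ for every $k\in\omega$; (ii) for every sequence $\{U_n\}_{n\in\omega}$ of open subsets of $G$ such that $e\in\overline{U_n}$ for every $n\in\omega$, there are a strictly increasing sequence $(n_k)_{k\in\omega}$ in $\omega$ and a sequence $\{x_k\}_{k\in\omega}$ in $G$ such that $x_k\in U_{n_k}$ for every $k\in\omega$ and $x_k\to e$; (iii) $G$ is a $\kappa$-Fréchet–Urysohn space.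
   Context: $\omega=\{0,1,2,\dots\}$. All topological groups are assumed Hausdorff (hence Tychonoff). A Tychonoff space $X$ is called $\kappa$-Fréchet–Urysohn if, for any open set $U\subseteq X$ and each point $x\in\overline{U}$, there exists a sequence $\{x_n\}_{n\in\omega}\subseteq U$ that converges to $x$. An indexed family $\mathcal{A}=\{A_n\}_{n\in\omega}$ of subsets of a space $X$ weakly converges to a point $x\in X$ if for every neighborhood $W$ of $x$ there are a sequence $\{a_n\}_{n\in\omega}$ and $m\in\omega$ such that $a_n\in A_n$ for every $n\in\omega$ and $a_n\in W$ for every $n>m$. (In (i), the family $\mathcal{V}_n$ is indexed by $i\in\omega$.) *)

theory Defs
  imports "HOL-Analysis.Analysis"
begin

definition weakly_converges :: "(nat \<Rightarrow> 'a::topological_space set) \<Rightarrow> 'a \<Rightarrow> bool" where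
  "weakly_converges A x \<longleftrightarrow>
     (\<forall>W. x \<in> interior W \<longrightarrow>
        (\<exists>(a :: nat \<Rightarrow> 'a) (m :: nat). (\<forall>n. a n \<in> A n) \<and> (\<forall>n>m. a n \<in> W)))"

text \<open>The notion is customarily reserved for Tychonoff spaces. The definition below does not
  repeat that restriction; it is automatic for Hausdorff topological groups.\<close>

definition kappa_Frechet_Urysohn :: "'a::topological_space itself \<Rightarrow> bool" where
  "kappa_Frechet_Urysohn _ \<longleftrightarrow>
     (\<forall>(U :: 'a set) x. open U \<longrightarrow> x \<in> closure U \<longrightarrow>
        (\<exists>s :: nat \<Rightarrow> 'a. (\<forall>n. s n \<in> U) \<and> s \<longlonglongrightarrow> x))"

text \<open>The group operation of \<^class>\<open>topological_group_add\<close> is written additively but is not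
  assumed commutative, so Hausdorff topological groups are the types of sort
  \<open>{topological_group_add, t2_space}\<close>, with identity \<open>0\<close>.\<close>

end

theory Submission
  imports Defs
begin

text \<open>The only implication with content is from the \<open>\<kappa>\<close>-Frechet-Urysohn property to the diagonal
  property for open sets \<open>U n\<close> accumulating at the identity. In a non-discrete group there is a
  sequence \<open>g n\<close> of non-identity elements converging to the identity. Separate \<open>g n\<close> from the
  identity by an open set \<open>P n\<close> whose closure misses it. The identity lies in the closure of the
  union of the sets \<open>(g n + U n) \<inter> P n\<close>, so it is the limit of a sequence in that union. Such a
  sequence meets each \<open>P n\<close> only finitely often, hence its indices tend to infinity, and translating
  back by \<open>- g n\<close> along a subsequence gives the required points.\<close>

text \<open>Thins out index sequences obtained by choice: since \<open>f\<close> tends to infinity,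
  each chosen index has a later one at which \<open>f\<close> is larger.\<close>

lemma at_top_imp_strict_mono_subseq:
  fixes f :: "nat \<Rightarrow> nat"
  assumes "filterlim f at_top sequentially"
  obtains r :: "nat \<Rightarrow> nat" where "strict_mono r" "strict_mono (f \<circ> r)"
proof -
  \<comment> \<open>\<open>True\<close> fills the slot for a pointwise invariant in
    \<open>dependent_nat_choice\<close>; only the relation between successive values
    matters.\<close>
  have "\<exists>r. \<forall>k. True \<and> (r k < r (Suc k) \<and> f (r k) < f (r (Suc k)))"
  proof (rule dependent_nat_choice)
    fix x k :: nat
    have "eventually (\<lambda>y. x < y \<and> f x < f y) sequentially"
      by (intro eventually_conj eventually_gt_at_top
          eventually_compose_filterlim[OF eventually_gt_at_top assms])
    then show "\<exists>y. True \<and> x < y \<and> f x < f y"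
      using eventually_happens by fastforce
  qed simp
  then show thesis
    using that by (auto simp: strict_mono_Suc_iff)
qed

lemma translate_closure:
  fixes U :: "'a::topological_group_add set"
  assumes "x \<in> closure U"
  shows "a + x \<in> closure ((+) a ` U)" and "x + a \<in> closure ((\<lambda>y. y + a) ` U)"
proof -
  have "(+) a ` closure U \<subseteq> closure ((+) a ` U)"
    by (intro image_closure_subset continuous_intros) (auto simp: closure_subset)
  then show "a + x \<in> closure ((+) a ` U)" using assms by blast
  have "(\<lambda>y. y + a) ` closure U \<subseteq> closure ((\<lambda>y. y + a) ` U)"
    by (intro image_closure_subset continuous_intros) (auto simp: closure_subset)
  then show "x + a \<in> closure ((\<lambda>y. y + a) ` U)" using assms by blast
qed

lemma open_translate:
  fixes U :: "'a::topological_group_add set"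
  assumes "open U"
  shows "open ((+) a ` U)" and "open ((\<lambda>y. y + a) ` U)"
proof -
  have "(+) a ` U = (\<lambda>y. - a + y) -` U"
    by (auto simp: image_iff add.assoc[symmetric] intro!: bexI[where x = "- a + _"])
  then show "open ((+) a ` U)"
    using assms by (auto intro!: open_vimage continuous_intros)
  have "(\<lambda>y. y + a) ` U = (\<lambda>y. y - a) -` U"
    by (auto simp: image_iff intro!: bexI[where x = "_ - a"])
  then show "open ((\<lambda>y. y + a) ` U)"
    using assms by (auto intro!: open_vimage continuous_intros)
qed

lemma kappa_Frechet_Urysohn_diagonal:
  fixes U :: "nat \<Rightarrow> 'a::{topological_group_add, t2_space} set"
  assumes FU: "kappa_Frechet_Urysohn TYPE('a)"
    and U: "\<And>n. open (U n)" "\<And>n. 0 \<in> closure (U n)"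
  shows "\<exists>(n :: nat \<Rightarrow> nat) x. strict_mono n \<and> (\<forall>k. x k \<in> U (n k)) \<and> x \<longlonglongrightarrow> 0"
proof (cases "(0::'a) \<in> closure (- {0})")
  case False
  \<comment> \<open>Here the identity is isolated, so it belongs to every \<open>U n\<close> and a
    constant sequence works.\<close>
  then have "- closure (- {0}) = {0::'a}"
    using closure_subset[of "- {0::'a}"] by blast
  then have "open {0::'a}"
    by (metis closed_closure open_Compl)
  then have "0 \<in> U n" for n
    using U(2)[of n] open_Int_closure_eq_empty[of "{0}" "U n"] by auto
  then show ?thesis
    by (intro exI[of _ "\<lambda>k. k"] exI[of _ "\<lambda>k. 0"]) (auto simp: strict_mono_def)
next
  case True
  then obtain g :: "nat \<Rightarrow> 'a" where g: "\<And>n. g n \<noteq> 0" "g \<longlonglongrightarrow> 0"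
    using FU[unfolded kappa_Frechet_Urysohn_def, rule_format, of "- {0}" 0] by auto
  have "\<forall>n. \<exists>P Q. open P \<and> open Q \<and> g n \<in> P \<and> 0 \<in> Q \<and> P \<inter> Q = {}"
    using g(1) hausdorff by blast
  then obtain P Q where PQ: "\<And>n. open (P n)" "\<And>n. open (Q n)" "\<And>n. g n \<in> P n"
      "\<And>n. 0 \<in> Q n" "\<And>n. P n \<inter> Q n = {}"
    by metis
  define V where "V = (\<Union>n. (+) (g n) ` U n \<inter> P n)"
  have "g n \<in> closure ((+) (g n) ` U n \<inter> P n)" for n
  proof -
    have "g n \<in> closure ((+) (g n) ` U n)"
      using translate_closure(1)[OF U(2), of "g n" n] by simp
    \<comment> \<open>Cutting down to the open neighbourhood \<open>P n\<close> of
      \<open>g n\<close> keeps \<open>g n\<close> in the closure.\<close>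
    then have "g n \<in> P n \<inter> closure ((+) (g n) ` U n)"
      using PQ(3) by blast
    then show ?thesis
      using open_Int_closure_subset[OF PQ(1)] by (metis inf_commute subsetD)
  qed
  then have "g n \<in> closure V" for n
    unfolding V_def by (meson UNIV_I UN_upper closure_mono subsetD)
  then have "0 \<in> closure V"
    using g(2) closed_closure closed_sequentially by blast
  moreover have "open V"
    unfolding V_def by (intro open_UN ballI open_Int open_translate U PQ)
  ultimately obtain y where y: "\<And>k. y k \<in> V" "y \<longlonglongrightarrow> 0"
    using FU unfolding kappa_Frechet_Urysohn_def by blast
  have "\<forall>k. \<exists>m. y k \<in> (+) (g m) ` U m \<inter> P m"
    using y(1) unfolding V_def by blast
  then obtain m where m: "\<And>k. y k \<in> (+) (g (m k)) ` U (m k)" "\<And>k. y k \<in> P (m k)"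
    by (metis IntE)
  have "eventually (\<lambda>k. N \<le> m k) sequentially" for N
  proof -
    \<comment> \<open>Finitely many neighbourhoods \<open>Q j\<close> of 0 eventually all contain
      \<open>y k\<close>. As \<open>y k\<close> also lies in \<open>P (m k)\<close>, which is
      disjoint from \<open>Q (m k)\<close>, the index \<open>m k\<close> cannot be below
      \<open>N\<close>.\<close>
    have "eventually (\<lambda>k. \<forall>j\<in>{..<N}. y k \<in> Q j) sequentially"
      using topological_tendstoD[OF y(2) PQ(2,4)] by (intro eventually_ball_finite) auto
    then show ?thesis
    proof eventually_elim
      case (elim k)
      then show ?case
        using m(2)[of k] PQ(5)[of "m k"] by (metis IntI empty_iff lessThan_iff not_le)
    qed
  qed
  then obtain r :: "nat \<Rightarrow> nat" where r: "strict_mono r" "strict_mono (m \<circ> r)"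
    using at_top_imp_strict_mono_subseq[of m] by (auto simp: filterlim_at_top)
  \<comment> \<open>Strict monotonicity of \<open>m \<circ> r\<close> makes
    \<open>g \<circ> (m \<circ> r)\<close> a subsequence of \<open>g\<close>, so both summands tend
    to 0.\<close>
  have "(\<lambda>k. - (g \<circ> (m \<circ> r)) k + (y \<circ> r) k) \<longlonglongrightarrow> - 0 + 0"
    by (intro tendsto_intros LIMSEQ_subseq_LIMSEQ r g(2) y(2))
  moreover have "- g (m k) + y k \<in> U (m k)" for k
    using m(1)[of k] by (auto simp: add.assoc[symmetric])
  ultimately show ?thesis
    using r(2) by (intro exI[of _ "m \<circ> r"] exI[of _ "\<lambda>k. - g (m (r k)) + y (r k)"]) auto
qed

text \<open>Translate \<open>a\<close> to the identity, apply the diagonal property to a constant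
  sequence of sets, and translate back.\<close>

lemma diagonal_imp_kappa_Frechet_Urysohn:
  assumes "\<And>U :: nat \<Rightarrow> 'a::topological_group_add set.
      (\<And>n. open (U n)) \<Longrightarrow> (\<And>n. 0 \<in> closure (U n)) \<Longrightarrow>
      \<exists>(n :: nat \<Rightarrow> nat) x. strict_mono n \<and> (\<forall>k. x k \<in> U (n k)) \<and> x \<longlonglongrightarrow> 0"
  shows "kappa_Frechet_Urysohn TYPE('a)"
  unfolding kappa_Frechet_Urysohn_def
proof (intro allI impI)
  fix U :: "'a set" and a assume U: "open U" "a \<in> closure U"
  have "0 \<in> closure ((\<lambda>y. y + - a) ` U)"
    using translate_closure(2)[OF U(2), of "- a"] by simp
  then obtain x :: "nat \<Rightarrow> 'a" where x: "\<And>k. x k \<in> (\<lambda>y. y + - a) ` U" "x \<longlonglongrightarrow> 0"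
    using assms[of "\<lambda>_. (\<lambda>y. y + - a) ` U"] open_translate(2)[OF U(1), of "- a"] by blast
  have "(\<lambda>k. x k + a) \<longlonglongrightarrow> 0 + a"
    by (intro tendsto_intros x(2))
  moreover have "x k + a \<in> U" for k
    using x(1)[of k] by auto
  ultimately show "\<exists>s. (\<forall>n. s n \<in> U) \<and> s \<longlonglongrightarrow> a"
    by (intro exI[of _ "\<lambda>k. x k + a"]) simp
qed

text \<open>The witnessing sequence may depend on \<open>W\<close>, so one point of \<open>U\<close>
  in \<open>W\<close>, repeated forever, suffices.\<close>

lemma weakly_converges_const:
  assumes "x \<in> closure U"
  shows "weakly_converges (\<lambda>_. U) x"
  unfolding weakly_converges_def
proof (intro allI impI)
  fix W assume "x \<in> interior W"
  then obtain u where "u \<in> U" "u \<in> W"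
    using assms open_Int_closure_eq_empty[OF open_interior, of W U] interior_subset by blast
  then show "\<exists>a (m::nat). (\<forall>n. a n \<in> U) \<and> (\<forall>n>m. a n \<in> W)"
    by (intro exI[of _ "\<lambda>_. u"]) auto
qed

text \<open>Passing to tails is what later forces the inner indices to grow.\<close>

lemma weakly_converges_imp_closure_tail:
  assumes "weakly_converges A x"
  shows "x \<in> closure (\<Union>i\<in>{n..}. A i)"
  unfolding closure_iff_nhds_not_empty
proof (intro allI impI)
  fix W S assume "S \<subseteq> W" "open S" "x \<in> S"
  then have "x \<in> interior W"
    by (meson interiorI)
  then obtain a m where "\<And>i. a i \<in> A i" "\<And>i. i > m \<Longrightarrow> a i \<in> W"
    using assms unfolding weakly_converges_def by metis
  \<comment> \<open>The index \<open>n + Suc m\<close> is both at least \<open>n\<close>, hence in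
    the tail, and above \<open>m\<close>, hence with its point in \<open>W\<close>.\<close>
  then have "a (n + Suc m) \<in> A (n + Suc m)" "a (n + Suc m) \<in> W"
    by auto
  then show "(\<Union>i\<in>{n..}. A i) \<inter> W \<noteq> {}"
    using le_add1 by blast
qed

text \<open>Apply the diagonal property to the unions of the tails from \<open>n\<close> on of the
  families \<open>V n\<close>. The inner indices then satisfy \<open>i k \<ge> n k\<close>, so they
  tend to infinity, and one common subsequence makes both index sequences strictly
  increasing.\<close>

lemma diagonal_imp_diagonal_weakly_converges:
  fixes V :: "nat \<Rightarrow> nat \<Rightarrow> 'a::topological_space set"
  assumes diag: "\<And>U :: nat \<Rightarrow> 'a set.
      (\<And>n. open (U n)) \<Longrightarrow> (\<And>n. a \<in> closure (U n)) \<Longrightarrow>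
      \<exists>(n :: nat \<Rightarrow> nat) x. strict_mono n \<and> (\<forall>k. x k \<in> U (n k)) \<and> x \<longlonglongrightarrow> a"
    and V: "\<And>n i. open (V n i)" "\<And>n. weakly_converges (V n) a"
  shows "\<exists>(i :: nat \<Rightarrow> nat) (n :: nat \<Rightarrow> nat) x.
    strict_mono i \<and> strict_mono n \<and> x \<longlonglongrightarrow> a \<and> (\<forall>k. x k \<in> V (n k) (i k))"
proof -
  have "\<exists>(n :: nat \<Rightarrow> nat) x. strict_mono n \<and> (\<forall>k. x k \<in> (\<Union>i\<in>{n k..}. V (n k) i)) \<and> x \<longlonglongrightarrow> a"
    by (intro diag[of "\<lambda>n. \<Union>i\<in>{n..}. V n i"] open_UN ballI V(1)
        weakly_converges_imp_closure_tail V(2))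
  then obtain n :: "nat \<Rightarrow> nat" and x where n: "strict_mono n"
      and x: "\<forall>k. \<exists>i. i \<ge> n k \<and> x k \<in> V (n k) i" "x \<longlonglongrightarrow> a"
    by fastforce
  from x(1) obtain i where i: "\<And>k. i k \<ge> n k" "\<And>k. x k \<in> V (n k) (i k)"
    by metis
  have "filterlim i at_top sequentially"
    by (rule filterlim_at_top_mono[OF filterlim_subseq[OF n]]) (simp add: i(1))
  then obtain r :: "nat \<Rightarrow> nat" where r: "strict_mono r" "strict_mono (i \<circ> r)"
    by (rule at_top_imp_strict_mono_subseq)
  then show ?thesis
    using i(2) LIMSEQ_subseq_LIMSEQ[OF x(2) r(1)] strict_mono_o[OF n r(1)]
    by (intro exI[of _ "i \<circ> r"] exI[of _ "n \<circ> r"] exI[of _ "x \<circ> r"]) auto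
qed

theorem theorem2p1:
  shows
   "((\<forall>V :: nat \<Rightarrow> nat \<Rightarrow> 'a::{topological_group_add, t2_space} set.
        (\<forall>n i. open (V n i)) \<longrightarrow> (\<forall>n. weakly_converges (V n) 0) \<longrightarrow>
        (\<exists>(i :: nat \<Rightarrow> nat) (n :: nat \<Rightarrow> nat) (x :: nat \<Rightarrow> 'a).
           strict_mono i \<and> strict_mono n \<and> x \<longlonglongrightarrow> 0 \<and> (\<forall>k. x k \<in> V (n k) (i k))))
     \<longleftrightarrow>
     (\<forall>U :: nat \<Rightarrow> 'a set.
        (\<forall>n. open (U n)) \<longrightarrow> (\<forall>n. 0 \<in> closure (U n)) \<longrightarrow>
        (\<exists>(n :: nat \<Rightarrow> nat) (x :: nat \<Rightarrow> 'a).
           strict_mono n \<and> (\<forall>k. x k \<in> U (n k)) \<and> x \<longlonglongrightarrow> 0)))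
    \<and>
    ((\<forall>U :: nat \<Rightarrow> 'a set.
        (\<forall>n. open (U n)) \<longrightarrow> (\<forall>n. 0 \<in> closure (U n)) \<longrightarrow>
        (\<exists>(n :: nat \<Rightarrow> nat) (x :: nat \<Rightarrow> 'a).
           strict_mono n \<and> (\<forall>k. x k \<in> U (n k)) \<and> x \<longlonglongrightarrow> 0))
     \<longleftrightarrow>
     kappa_Frechet_Urysohn TYPE('a))"
proof (intro conjI iffI allI impI, goal_cases)
  case (1 U)
  \<comment> \<open>Each \<open>U n\<close> becomes a constant family, for which the inner index
    carries no information.\<close>
  have "\<forall>n. weakly_converges (\<lambda>_. U n) 0"
    using 1(3) by (simp add: weakly_converges_const)
  then obtain i n :: "nat \<Rightarrow> nat" and x where "strict_mono n" "x \<longlonglongrightarrow> 0" "\<forall>k. x k \<in> U (n k)"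
    using 1(1)[rule_format, of "\<lambda>n _. U n"] 1(2) by auto
  then show ?case
    by blast
next
  case (2 V)
  show ?case
    using 2(2,3) by (intro diagonal_imp_diagonal_weakly_converges 2(1)[rule_format]) simp_all
next
  case 3
  show ?case
    by (intro diagonal_imp_kappa_Frechet_Urysohn 3[rule_format])
next
  case (4 U)
  show ?case
    using 4(2,3) by (intro kappa_Frechet_Urysohn_diagonal 4(1)) simp_all
qed

end
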